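(* Let $\mathbb D=\bigcup_{k\in\mathbb N}\mathcal D(n_k,c_{k,1},c_{k,2})$ and $\mathbb D'=\bigcup_{k\in\mathbb N}\mathcal D(n'_k,c'_{k,1},c'_{k,2})$ be infinite families of sequences. If $\mathbb D$ is not almost fully graphic, then $\mathbb D'$ is not P-stable, provided that (1) $\lim_{k\to\infty}(n'_k-n_k)/\ln(n'_k)=+\infty$, (2) $c'_{k,2}\le c_{k,2}$ for all $k$, (3) $c'_{k,1}\ge c_{k,1}+(n'_k-n_k)$ for all $k$.
   Context: $\mathcal D(n,c_1,c_2)$ ($n>c_1\ge c_2$) is the set of integer sequences $(d_1,\dots,d_n)$ with $c_1\ge d_1\ge\dots\ge d_n\ge c_2$ and $\sum_i d_i$ even. A family is fully graphic if all members are graphic, almost fully graphic if it is fully graphic after removing finitely many members. For an integer sequence $D$ of length $n$, $\mathcal G(D)$ is the set of simple graphs on labelled vertices $v_1,\dots,v_n$ with $\deg(v_i)=d_i$ (empty if some entry negative); $D$ is graphic if $\mathcal G(D)\neq\emptyset$; $\mathrm{pp}(D)=\sum_{1\le i<j\le n}|\mathcal G(D+1^{-i}_{-j})|/|\mathcal G(D)|$ where $1^{-i}_{-j}$ has $-1$ in coordinates $i,j$ and $0$ elsewhere. A family is P-stable if there is a polynomial $p$ with $\mathrm{pp}(D)\le p(n)$ for all graphic members $D$ of length $n$.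
   Formalization: The bounds c_{k,1}, c_{k,2}, c'_{k,1}, c'_{k,2} are taken to be natural numbers; with negative bounds the claim fails, e.g. n_k even, n'_k=2n_k, c_{k,1}=c_{k,2}=c'_{k,2}=-n_k, c'_{k,1}=0. *)

theory Defs
  imports Complex_Main "HOL-Library.Ramsey" "HOL-Computational_Algebra.Polynomial"
begin

text \<open>
  An integer sequence of length \<open>n\<close> is an \<open>int list\<close>; its entries are indexed from 0, so the
  vertices \<open>v_1, \<dots>, v_n\<close> of its realizations are the numbers \<open>0, \<dots>, n - 1\<close>. A simple graph is
  given by its set of edges, each edge being a two-element set of vertices.
\<close>

definition vdegree :: "nat set set \<Rightarrow> nat \<Rightarrow> nat" where
  "vdegree E v = card {e \<in> E. v \<in> e}"

definition realizations :: "int list \<Rightarrow> nat set set set" where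
  "realizations D =
     {E. E \<subseteq> nsets {..<length D} 2 \<and> (\<forall>v<length D. int (vdegree E v) = D ! v)}"

definition graphic :: "int list \<Rightarrow> bool" where
  "graphic D \<longleftrightarrow> realizations D \<noteq> {}"

definition decrease :: "nat \<Rightarrow> nat \<Rightarrow> int list \<Rightarrow> int list" where
  "decrease i j D = D[i := D ! i - 1, j := D ! j - 1]"

text \<open>Only meaningful for graphic \<open>D\<close>: otherwise the denominator is 0.\<close>

definition pp :: "int list \<Rightarrow> real" where
  "pp D = (\<Sum>(i, j) \<in> {(i, j). i < j \<and> j < length D}.
             real (card (realizations (decrease i j D))) / real (card (realizations D)))"

text \<open>
  The bounds are natural numbers. With negative bounds the sequences of \<open>\<D>(n, c\<^sub>1, c\<^sub>2)\<close> could be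
  non-graphic merely because of negative entries. The condition \<open>n > c\<^sub>1 \<ge> c\<^sub>2\<close> is not part of this
  definition and is to be assumed where the set is used.
\<close>

definition degree_interval :: "nat \<Rightarrow> nat \<Rightarrow> nat \<Rightarrow> int list set" where
  "degree_interval n c1 c2 =
     {D. length D = n \<and> sorted_wrt (\<ge>) D \<and> set D \<subseteq> {int c2..int c1} \<and> even (sum_list D)}"

definition fully_graphic :: "int list set \<Rightarrow> bool" where
  "fully_graphic F \<longleftrightarrow> (\<forall>D\<in>F. graphic D)"

definition almost_fully_graphic :: "int list set \<Rightarrow> bool" where
  "almost_fully_graphic F \<longleftrightarrow> (\<exists>R. finite R \<and> R \<subseteq> F \<and> fully_graphic (F - R))"

definition P_stable :: "int list set \<Rightarrow> bool" where
  "P_stable F \<longleftrightarrow>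
     (\<exists>p :: real poly. \<forall>D\<in>F. graphic D \<longrightarrow> pp D \<le> poly p (real (length D)))"

end

(*
  Only finitely many sequences belong to each index, so infinitely many indices k carry a
  non-graphic sequence, and the Erdos-Gallai inequality it violates yields a number m with
  c2 <= m <= c1 and (n - m) c2 <= m (c1 + 1 - m). Hence a clique of m vertices and an independent
  set of n - m vertices can be joined so evenly that no degree is below c2 and none exceeds c1.
  The s = n' - n additional vertices form a half graph: one side extends the clique, the other
  side extends the independent set and is completely joined to the old clique.
  A weighting of the vertices shows that every realization of the resulting degree sequence
  contains exactly this half graph. Lowering two of its degrees by one, however, allows 2^(t-1)
  replacements of it, t being about s / 4, so pp is at least 2^(t-1). As s / ln n' tends to
  infinity, this exceeds every polynomial in n'.
*)
theory Submission
  imports Defs "HOL-Combinatorics.Permutations"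
begin

section \<open>Degrees and neighbourhoods in simple graphs\<close>

lemma finite_simple_graph: "E \<subseteq> nsets {..<n::nat} 2 \<Longrightarrow> finite E"
  by (meson finite_imp_finite_nsets finite_lessThan finite_subset)

lemma vdegree_empty [simp]: "vdegree {} v = 0"
  by (simp add: vdegree_def)

lemma vdegree_Un_disjoint:
  assumes "finite E" "finite F" "E \<inter> F = {}"
  shows "vdegree (E \<union> F) v = vdegree E v + vdegree F v"
proof -
  have "{e \<in> E \<union> F. v \<in> e} = {e \<in> E. v \<in> e} \<union> {e \<in> F. v \<in> e}" by auto
  then show ?thesis
    unfolding vdegree_def using assms by (simp add: card_Un_disjoint disjoint_iff)
qed

lemma vdegree_insert:
  "finite E \<Longrightarrow> e \<notin> E \<Longrightarrow> vdegree (insert e E) v = vdegree E v + of_bool (v \<in> e)"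
  using vdegree_Un_disjoint[of "{e}" E v]
  by (auto simp: vdegree_def Collect_conv_if conj_commute)

lemma vdegree_switch:
  assumes "finite E" "finite A" "R \<subseteq> E" "A \<inter> E = {}"
  shows "vdegree (E - R \<union> A) v + vdegree R v = vdegree E v + vdegree A v"
proof -
  have R: "finite R" using assms finite_subset by blast
  have "vdegree E v = vdegree (E - R) v + vdegree R v"
    using vdegree_Un_disjoint[of "E - R" R v] assms R by (simp add: Un_absorb2 inf_commute)
  moreover have "vdegree (E - R \<union> A) v = vdegree (E - R) v + vdegree A v"
    using assms by (intro vdegree_Un_disjoint) auto
  ultimately show ?thesis by simp
qed

lemma vdegree_image:
  assumes "finite I" "inj_on f I"
  shows "vdegree (f ` I) v = (\<Sum>i\<in>I. of_bool (v \<in> f i))"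
  using assms by induction (auto simp: vdegree_insert)

text \<open>Double counting of incidences. Degrees alone thus determine the total weight of the
  edges; the handshake lemma, the Erdos-Gallai argument and the rigidity of the half graph all rest
  on this.\<close>

lemma sum_weighted_vdegree:
  fixes w :: "nat \<Rightarrow> int"
  assumes "E \<subseteq> nsets {..<n} 2"
  shows "(\<Sum>v<n. w v * int (vdegree E v)) = (\<Sum>e\<in>E. \<Sum>v\<in>e. w v)"
proof -
  have fin: "finite E" using assms by (rule finite_simple_graph)
  have "int (vdegree E v) = (\<Sum>e\<in>E. of_bool (v \<in> e))" for v
    using vdegree_image[OF fin inj_on_id] by simp
  then have "(\<Sum>v<n. w v * int (vdegree E v)) = (\<Sum>v<n. \<Sum>e\<in>E. w v * of_bool (v \<in> e))"
    by (simp add: sum_distrib_left)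
  also have "\<dots> = (\<Sum>e\<in>E. \<Sum>v<n. w v * of_bool (v \<in> e))" by (rule sum.swap)
  also have "\<dots> = (\<Sum>e\<in>E. \<Sum>v\<in>e. w v)"
  proof (rule sum.cong[OF refl])
    fix e assume "e \<in> E"
    then have "e \<subseteq> {..<n}" using assms by (auto simp: nsets_def)
    then show "(\<Sum>v<n. w v * of_bool (v \<in> e)) = (\<Sum>v\<in>e. w v)"
      by (intro sum.mono_neutral_cong_right) auto
  qed
  finally show ?thesis .
qed

lemma even_sum_vdegree:
  assumes "E \<subseteq> nsets {..<n} 2"
  shows "even (\<Sum>v<n. vdegree E v)"
proof -
  have "(\<Sum>e\<in>E. \<Sum>v\<in>e. 1::int) = (\<Sum>e\<in>E. 2)"
    using assms by (intro sum.cong) (auto simp: nsets_def)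
  then have "int (\<Sum>v<n. vdegree E v) = 2 * int (card E)"
    using sum_weighted_vdegree[OF assms, of "\<lambda>_. 1"] by simp
  then show ?thesis by presburger
qed

definition nbrs :: "nat set set \<Rightarrow> nat \<Rightarrow> nat set" where
  "nbrs E v = {u. {u, v} \<in> E}"

lemma nbrs_sym: "u \<in> nbrs E v \<longleftrightarrow> v \<in> nbrs E u"
  by (simp add: nbrs_def insert_commute)

lemma nbrs_subset: "E \<subseteq> nsets {..<n} 2 \<Longrightarrow> nbrs E v \<subseteq> {..<n} - {v}"
proof
  fix u assume "E \<subseteq> nsets {..<n} 2" "u \<in> nbrs E v"
  then have "{u, v} \<in> nsets {..<n} 2" unfolding nbrs_def by blast
  then show "u \<in> {..<n} - {v}" by (cases "u = v") (auto simp: nsets_def)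
qed

lemma finite_nbrs: "E \<subseteq> nsets {..<n} 2 \<Longrightarrow> finite (nbrs E v)"
  by (meson finite_Diff finite_lessThan finite_subset nbrs_subset)

lemma vdegree_eq_card_nbrs:
  assumes "E \<subseteq> nsets {..<n} 2"
  shows "vdegree E v = card (nbrs E v)"
proof -
  have "\<exists>u. e = {u, v}" if "e \<in> E" "v \<in> e" for e
  proof -
    have "card e = 2" using that assms by (auto simp: nsets_def)
    with \<open>v \<in> e\<close> show ?thesis by (auto simp: card_2_iff)
  qed
  then have "{e \<in> E. v \<in> e} = (\<lambda>u. {u, v}) ` nbrs E v"
    by (auto simp: nbrs_def)
  moreover have "inj_on (\<lambda>u. {u, v}) (nbrs E v)"
    by (auto simp: inj_on_def doubleton_eq_iff)
  ultimately show ?thesis by (simp add: vdegree_def card_image)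
qed

lemma obtain_private_neighbour:
  assumes "E \<subseteq> nsets {..<n} 2" "vdegree E v < vdegree E u"
  obtains x where "x \<in> nbrs E u" "x \<notin> nbrs E v" "x \<noteq> v"
proof -
  have "\<exists>x \<in> nbrs E u. x \<notin> nbrs E v \<and> x \<noteq> v"
  proof (rule ccontr)
    assume "\<not> ?thesis"
    \<comment> \<open>Deleting \<open>v\<close> on one side and \<open>u\<close> on the other
      discounts a possible edge between the two, so the larger degree of \<open>u\<close> still
      shows.\<close>
    then have sub: "nbrs E u - {v} \<subseteq> nbrs E v - {u}"
      using nbrs_subset[OF assms(1), of u] by auto
    have fin: "finite (nbrs E u)" "finite (nbrs E v)" using finite_nbrs[OF assms(1)] by auto
    have "card (nbrs E u - {v}) \<le> card (nbrs E v - {u})" using sub fin by (intro card_mono) auto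
    moreover have "v \<in> nbrs E u \<longleftrightarrow> u \<in> nbrs E v" by (rule nbrs_sym)
    moreover have "card (nbrs E v) < card (nbrs E u)"
      using assms by (simp add: vdegree_eq_card_nbrs)
    moreover have "0 < card (nbrs E v)" if "u \<in> nbrs E v"
      using that fin by (auto simp: card_gt_0_iff)
    ultimately show False using fin by (cases "u \<in> nbrs E v") (simp_all add: card_Diff_singleton_if)
  qed
  then show ?thesis using that by blast
qed

section \<open>Erdos-Gallai inequalities and the consequence of a violation\<close>

text \<open>A stage of a greedy construction: the vertices below \<open>r\<close> are finished,
  \<open>r\<close> is being filled up, and the vertices above \<open>r\<close> stay independent
  until their turn comes.\<close>

definition subrealization :: "(nat \<Rightarrow> nat) \<Rightarrow> nat \<Rightarrow> nat \<Rightarrow> nat set set \<Rightarrow> bool" where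
  "subrealization d n r E \<longleftrightarrow> E \<subseteq> nsets {..<n} 2 \<and> (\<forall>v<r. vdegree E v = d v) \<and>
     (\<forall>v<n. vdegree E v \<le> d v) \<and> (\<forall>e\<in>E. \<exists>v\<in>e. v \<le> r)"

text \<open>Reduces every switch below to a count of its effect on single degrees: \<open>R\<close>
  leaves, \<open>A\<close> enters, finished vertices keep their degree, \<open>r\<close> gains, and
  no vertex exceeds its target.\<close>

lemma subrealization_switch:
  assumes "subrealization d n r E" "R \<subseteq> E" "A \<inter> E = {}" "A \<subseteq> nsets {..<n} 2"
    and "\<And>e. e \<in> A \<Longrightarrow> \<exists>v\<in>e. v \<le> r"
    and "\<And>v. v < r \<Longrightarrow> vdegree A v = vdegree R v"
    and "\<And>v. v < n \<Longrightarrow> vdegree E v + vdegree A v \<le> d v + vdegree R v"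
    and "vdegree R r < vdegree A r"
  shows "\<exists>E'. subrealization d n r E' \<and> vdegree E r < vdegree E' r"
proof (intro exI conjI)
  let ?E = "E - R \<union> A"
  have E: "E \<subseteq> nsets {..<n} 2" using assms(1) by (simp add: subrealization_def)
  have sw: "vdegree ?E v + vdegree R v = vdegree E v + vdegree A v" for v
    using vdegree_switch[OF finite_simple_graph[OF E] finite_simple_graph[OF assms(4)] assms(2,3)] .
  show "vdegree E r < vdegree ?E r" using sw[of r] assms(8) by simp
  show "subrealization d n r ?E"
    unfolding subrealization_def
  proof (intro conjI allI impI ballI)
    show "?E \<subseteq> nsets {..<n} 2" using E assms(4) by blast
    show "vdegree ?E v = d v" if "v < r" for v
      using sw[of v] assms(6)[OF that] that assms(1) by (simp add: subrealization_def)
    show "vdegree ?E v \<le> d v" if "v < n" for v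
      using sw[of v] assms(7)[OF that] by simp
    show "\<exists>v\<in>e. v \<le> r" if "e \<in> ?E" for e
      using that assms(1,5) by (auto simp: subrealization_def)
  qed
qed

text \<open>The switches of Tripathi, Venugopalan and West: if none of them applies, the first
  \<open>r + 1\<close> vertices form a clique, the others are independent, and the \<open>r\<close>-th Erdos-Gallai
  inequality is violated.\<close>

lemma subrealization_improve:
  assumes sub: "subrealization d n r E" and r: "r < n" and def: "vdegree E r < d r"
    and mono: "\<And>i j. i \<le> j \<Longrightarrow> j < n \<Longrightarrow> d j \<le> d i"
    and even: "even (\<Sum>v<n. d v)"
    and EG: "(\<Sum>i\<le>r. d i) \<le> Suc r * r + (\<Sum>i\<in>{r<..<n}. min (Suc r) (d i))"
  shows "\<exists>E'. subrealization d n r E' \<and> vdegree E r < vdegree E' r"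
proof (rule ccontr)
  assume no: "\<not> ?thesis"
  have E: "E \<subseteq> nsets {..<n} 2" and sat: "\<And>v. v < r \<Longrightarrow> vdegree E v = d v"
    and le: "\<And>v. v < n \<Longrightarrow> vdegree E v \<le> d v" and ind: "\<And>e. e \<in> E \<Longrightarrow> \<exists>v\<in>e. v \<le> r"
    using sub by (auto simp: subrealization_def)
  have nbr_less: "x < n" "x \<noteq> v" if "x \<in> nbrs E v" for x v
    using nbrs_subset[OF E, of v] that by auto
  have edge: "{x, v} \<in> E" "{v, x} \<in> E" if "x \<in> nbrs E v" for x v
    using that by (auto simp: nbrs_def insert_commute)
  have nonedge: "{x, v} \<notin> E" "{v, x} \<notin> E" if "x \<notin> nbrs E v" for x v
    using that by (auto simp: nbrs_def insert_commute)
  have deficient_adj: "v \<in> nbrs E r" if v: "v < n" "v \<noteq> r" "vdegree E v < d v" for v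
  proof (rule ccontr)
    assume "v \<notin> nbrs E r"
    then have "\<exists>E'. subrealization d n r E' \<and> vdegree E r < vdegree E' r"
      using v r def le sat nonedge[of v r]
      by (intro subrealization_switch[OF sub, of "{}" "{{v, r}}"])
        (auto simp: vdegree_insert Suc_le_eq)
    with no show False by blast
  qed
  have saturated_gt: "vdegree E r < vdegree E v" if "v < r" for v
    using sat[OF that] def mono[of v r] that r by simp
  have saturated_adj: "v \<in> nbrs E r" if v: "v < r" for v
  proof (rule ccontr)
    assume nv: "v \<notin> nbrs E r"
    obtain u where u: "u \<in> nbrs E v" "u \<notin> nbrs E r" "u \<noteq> r"
      using obtain_private_neighbour[OF E saturated_gt[OF v]] by blast
    have "\<exists>E'. subrealization d n r E' \<and> vdegree E r < vdegree E' r"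
    \<comment> \<open>Trading \<open>{u, v}\<close> for \<open>{u, r}\<close> and
      \<open>{v, r}\<close> raises \<open>r\<close> by 2 and changes no other degree, so it needs a
      deficit of 2 at \<open>r\<close>.\<close>
    proof (cases "vdegree E r + 2 \<le> d r")
      case True
      then show ?thesis
        using u v r nv True le[of u] le[of v] nbr_less[OF u(1)] edge[OF u(1)] nonedge[OF u(2)] nonedge[OF nv]
        by (intro subrealization_switch[OF sub, of "{{u, v}}" "{{u, r}, {v, r}}"])
          (auto simp: vdegree_insert doubleton_eq_iff le)
    next
      case False
      \<comment> \<open>With deficit 1, evenness of the degree sum provides a second deficient
        vertex \<open>k\<close>. It is adjacent to \<open>r\<close>; deleting \<open>{k, r}\<close>
        as well leaves \<open>r\<close> a net gain of 1.\<close>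
      have "\<exists>k<n. k \<noteq> r \<and> vdegree E k < d k"
      proof (rule ccontr)
        assume "\<not> ?thesis"
        then have eq: "vdegree E k = d k" if "k \<in> {..<n} - {r}" for k
          using that le[of k] by force
        have "(\<Sum>k<n. d k) = d r + (\<Sum>k\<in>{..<n} - {r}. d k)"
          using r by (intro sum.remove) auto
        moreover have "(\<Sum>k<n. vdegree E k) = vdegree E r + (\<Sum>k\<in>{..<n} - {r}. d k)"
          using r eq by (subst sum.remove[of _ r]) auto
        moreover have "d r = Suc (vdegree E r)" using False def by simp
        ultimately show False using even even_sum_vdegree[OF E] by simp
      qed
      then obtain k where k: "k < n" "k \<noteq> r" "vdegree E k < d k" by blast
      have "\<not> k < r" using sat k by force
      moreover have kr: "k \<in> nbrs E r" using deficient_adj k by blast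
      ultimately show ?thesis
        using u v r k nv def le[of u] le[of v] le[of k] nbr_less[OF u(1)] edge[OF u(1)] nonedge[OF u(2)] nonedge[OF nv] edge[OF kr]
        by (intro subrealization_switch[OF sub, of "{{u, v}, {k, r}}" "{{u, r}, {v, r}}"])
          (auto simp: vdegree_insert doubleton_eq_iff le)
    qed
    with no show False by blast
  qed
  have indep: "u \<le> r" if "u \<in> nbrs E v" "r < v" for u v
    using ind[OF edge(1)[OF that(1)]] that by auto
  have full: "min (Suc r) (d k) \<le> vdegree E k" if k: "r < k" "k < n" for k
  proof (rule ccontr)
    assume "\<not> ?thesis"
    then have lt: "vdegree E k < d k" "card (nbrs E k) < Suc r"
      using vdegree_eq_card_nbrs[OF E] by auto
    have kr: "k \<in> nbrs E r" using deficient_adj k lt by auto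
    have "\<not> {..r} \<subseteq> nbrs E k"
      using card_mono[OF finite_nbrs[OF E], of "{..r}" k] lt by auto
    then obtain i where i: "i \<le> r" "i \<notin> nbrs E k" by auto
    have "i \<noteq> r" using i kr nbrs_sym by blast
    then have i_less: "i < r" using i by simp
    obtain u where u: "u \<in> nbrs E i" "u \<notin> nbrs E r" "u \<noteq> r"
      using obtain_private_neighbour[OF E saturated_gt[OF i_less]] by blast
    \<comment> \<open>Trade \<open>{u, i}\<close> for \<open>{u, r}\<close> and
      \<open>{i, k}\<close>: only \<open>r\<close> and the deficient \<open>k\<close> gain.\<close>
    have "u \<noteq> k" using u kr by blast
    then have "\<exists>E'. subrealization d n r E' \<and> vdegree E r < vdegree E' r"
      using u r k i_less lt def le[of u] le[of i] nbr_less[OF u(1)] edge[OF u(1)] nonedge[OF u(2)] nonedge[OF i(2)]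
      by (intro subrealization_switch[OF sub, of "{{u, i}}" "{{u, r}, {i, k}}"])
        (auto simp: vdegree_insert doubleton_eq_iff le)
    with no show False by blast
  qed
  have clique: "{i, j} \<in> E" if ij: "i < j" "j \<le> r" for i j
  proof (cases "j = r")
    case True
    then show ?thesis using saturated_adj[of i] ij edge by auto
  next
    case False
    with ij have lr: "i < r" "j < r" by auto
    show ?thesis
    proof (rule ccontr)
      assume nij: "{i, j} \<notin> E"
      obtain u where u: "u \<in> nbrs E i" "u \<notin> nbrs E r" "u \<noteq> r"
        using obtain_private_neighbour[OF E saturated_gt[OF lr(1)]] by blast
      obtain w where w: "w \<in> nbrs E j" "w \<notin> nbrs E r" "w \<noteq> r"
        using obtain_private_neighbour[OF E saturated_gt[OF lr(2)]] by blast
      \<comment> \<open>Trade \<open>{u, i}\<close>, \<open>{w, j}\<close> for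
        \<open>{u, r}\<close>, \<open>{i, j}\<close>. Only \<open>w\<close> loses, which is harmless
        above \<open>r\<close>; \<open>u = w\<close> is allowed.\<close>
      have "r < u" "r < w"
        using saturated_adj u w by (meson linorder_neqE_nat)+
      then have "\<exists>E'. subrealization d n r E' \<and> vdegree E r < vdegree E' r"
        using u r lr ij nij def le[of u] le[of i] le[of j] le[of w] nbr_less[OF u(1)] nbr_less[OF w(1)] edge[OF u(1)] edge[OF w(1)] nonedge[OF u(2)]
        by (intro subrealization_switch[OF sub, of "{{u, i}, {w, j}}" "{{u, r}, {i, j}}"])
          (auto simp: vdegree_insert doubleton_eq_iff le le_SucI)
      with no show False by blast
    qed
  qed
  \<comment> \<open>Edges within \<open>{..r}\<close> weigh 2 and no edge weighs less than 0.
    Bounding the total weight from below by the clique \<open>C\<close> yields the inequality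
    opposite to \<open>EG\<close>.\<close>
  define w :: "nat \<Rightarrow> int" where "w v = (if v \<le> r then 1 else - 1)" for v
  define C where "C = nsets {..r} 2"
  have C_sub: "C \<subseteq> E"
  proof
    fix e assume "e \<in> C"
    then obtain i j where e: "e = {i, j}" "i \<noteq> j" "i \<le> r" "j \<le> r"
      by (auto simp: C_def nsets_def card_2_iff)
    then show "e \<in> E" using clique[of i j] clique[of j i]
      by (cases "i < j") (auto simp: insert_commute)
  qed
  have "int (Suc r * r) = 2 * int (card C)"
  proof -
    have "card C = Suc r choose 2" by (simp add: C_def card_nsets)
    then have "2 * card C = Suc r * r" by (simp add: choose_two del: mult_Suc)
    then show ?thesis by linarith
  qed
  also have "\<dots> = (\<Sum>e\<in>C. \<Sum>v\<in>e. w v)"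
  proof -
    have "(\<Sum>v\<in>e. w v) = 2" if "e \<in> C" for e
    proof -
      have "(\<Sum>v\<in>e. w v) = (\<Sum>v\<in>e. 1)"
        using that by (intro sum.cong) (auto simp: C_def nsets_def w_def)
      then show ?thesis using that by (simp add: C_def nsets_def)
    qed
    then show ?thesis by simp
  qed
  also have "\<dots> \<le> (\<Sum>e\<in>E. \<Sum>v\<in>e. w v)"
  proof (intro sum_mono2[OF finite_simple_graph[OF E] C_sub])
    fix e assume "e \<in> E - C"
    then have "e \<in> nsets {..<n} 2" "\<exists>v\<in>e. v \<le> r" using E ind by auto
    then obtain x y where "e = {x, y}" "x \<noteq> y" "x \<le> r"
      by (auto simp: nsets_def card_2_iff)
    then show "0 \<le> (\<Sum>v\<in>e. w v)" by (simp add: w_def)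
  qed
  also have "\<dots> = (\<Sum>v<n. w v * int (vdegree E v))"
    using sum_weighted_vdegree[OF E] by simp
  also have "\<dots> = (\<Sum>v\<le>r. int (vdegree E v)) - (\<Sum>v\<in>{r<..<n}. int (vdegree E v))"
  proof -
    have "{..<n} = {..r} \<union> {r<..<n}" using r by auto
    then have "(\<Sum>v<n. w v * int (vdegree E v)) =
      (\<Sum>v\<le>r. w v * int (vdegree E v)) + (\<Sum>v\<in>{r<..<n}. w v * int (vdegree E v))"
      by (simp add: sum.union_disjoint disjoint_iff)
    then show ?thesis by (simp add: w_def sum_negf)
  qed
  finally have "Suc r * r + (\<Sum>v\<in>{r<..<n}. vdegree E v) \<le> (\<Sum>v\<le>r. vdegree E v)"
    by (simp flip: of_nat_sum of_nat_add of_nat_mult)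
  moreover have "(\<Sum>v\<in>{r<..<n}. min (Suc r) (d v)) \<le> (\<Sum>v\<in>{r<..<n}. vdegree E v)"
    by (intro sum_mono full) auto
  moreover have "(\<Sum>v\<le>r. vdegree E v) < (\<Sum>v\<le>r. d v)"
    using def le r by (intro sum_strict_mono_ex1) (auto intro!: bexI[of _ r])
  ultimately show False using EG by simp
qed

text \<open>The vertices are saturated one after another: a subrealization with the largest possible
  degree at \<open>r\<close> must reach \<open>d r\<close>, or else it could be improved. With
  indices from 0, \<open>Suc r * r\<close> is the usual k(k-1) for k = r + 1.\<close>

lemma Erdos_Gallai_sufficient:
  assumes mono: "\<And>i j. i \<le> j \<Longrightarrow> j < n \<Longrightarrow> d j \<le> d i"
    and even: "even (\<Sum>v<n. d v)"
    and EG: "\<And>r. r < n \<Longrightarrow> (\<Sum>i\<le>r. d i) \<le> Suc r * r + (\<Sum>i\<in>{r<..<n}. min (Suc r) (d i))"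
  obtains E where "E \<subseteq> nsets {..<n} 2" "\<And>v. v < n \<Longrightarrow> vdegree E v = d v"
proof -
  have "\<exists>E. subrealization d n r E" if "r \<le> n" for r
    using that
  proof (induction r)
    case 0
    then show ?case by (intro exI[of _ "{}"]) (simp add: subrealization_def)
  next
    case (Suc r)
    then have r: "r < n" by simp
    obtain E0 where E0: "subrealization d n r E0" using Suc by auto
    have bound: "\<forall>E. subrealization d n r E \<longrightarrow> vdegree E r < Suc (d r)"
      using r by (simp add: subrealization_def less_Suc_eq_le)
    then obtain E where E: "subrealization d n r E"
      and max: "\<And>F. subrealization d n r F \<Longrightarrow> vdegree F r \<le> vdegree E r"
      using ex_has_greatest_nat[of "subrealization d n r" E0 "\<lambda>E. vdegree E r", OF E0 bound]
      by blast
    have "\<not> vdegree E r < d r"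
      using subrealization_improve[OF E r _ mono even EG[OF r]] max by (meson linorder_not_le)
    then have "vdegree E r = d r" using bound E by (auto simp: less_Suc_eq)
    moreover have "\<forall>e\<in>E. \<exists>v\<in>e. v \<le> Suc r"
      using E unfolding subrealization_def by (meson le_SucI)
    ultimately have "subrealization d n (Suc r) E"
      using E by (simp add: subrealization_def less_Suc_eq)
    then show ?case by blast
  qed
  then obtain E where "subrealization d n n E" by blast
  then show ?thesis using that unfolding subrealization_def by blast
qed

text \<open>\<open>k\<close> is the index of a violated Erdos-Gallai inequality, which stays
  violated when its degrees are replaced by the extremes \<open>c1\<close> and \<open>c2\<close>. A
  value of \<open>k\<close> below \<open>c2\<close> would give n - 1 < \<open>c1\<close>; hence the
  minimum is \<open>c2\<close>, and rearranging yields the claim.\<close>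

lemma nongraphic_obtain_index:
  assumes D: "D \<in> degree_interval n c1 c2" and "c1 < n" and "\<not> graphic D"
  obtains k where "c2 \<le> k" "k \<le> c1" "(n - k) * c2 \<le> k * (c1 + 1 - k)"
proof -
  define d where "d v = nat (D ! v)" for v
  have len: "length D = n" and sorted: "sorted_wrt (\<ge>) D" and ev: "even (sum_list D)"
    using D by (auto simp: degree_interval_def)
  have "D ! v \<in> {int c2..int c1}" if "v < n" for v
    using D that len nth_mem[of v D] unfolding degree_interval_def by blast
  note range = this
  have int_d: "int (d v) = D ! v" and lo: "c2 \<le> d v" and hi: "d v \<le> c1" if "v < n" for v
    using range[OF that] by (auto simp: d_def le_nat_iff nat_le_iff)
  have mono: "d j \<le> d i" if "i \<le> j" "j < n" for i j
  proof (cases "i = j")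
    case False
    then show ?thesis
      using sorted_wrt_nth_less[OF sorted, of i j] that len by (simp add: d_def)
  qed simp
  have "int (\<Sum>v<n. d v) = sum_list D"
    using int_d by (simp add: sum_list_sum_nth len atLeast0LessThan)
  then have even: "even (\<Sum>v<n. d v)" using ev by (metis even_of_nat)
  have "\<exists>r<n. Suc r * r + (\<Sum>i\<in>{r<..<n}. min (Suc r) (d i)) < (\<Sum>i\<le>r. d i)"
  proof (rule ccontr)
    assume "\<not> ?thesis"
    then have EG: "(\<Sum>i\<le>r. d i) \<le> Suc r * r + (\<Sum>i\<in>{r<..<n}. min (Suc r) (d i))"
      if "r < n" for r using that by (meson not_less)
    obtain E where "E \<subseteq> nsets {..<n} 2" "\<And>v. v < n \<Longrightarrow> vdegree E v = d v"
      using Erdos_Gallai_sufficient[OF mono even EG] by blast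
    then have "E \<in> realizations D" using int_d by (simp add: realizations_def len)
    with \<open>\<not> graphic D\<close> show False by (auto simp: graphic_def)
  qed
  then obtain r where r: "r < n"
    and viol: "Suc r * r + (\<Sum>i\<in>{r<..<n}. min (Suc r) (d i)) < (\<Sum>i\<le>r. d i)" by blast
  define k where "k = Suc r"
  have "(\<Sum>i\<le>r. d i) \<le> (\<Sum>i\<le>r. c1)" using hi r by (intro sum_mono) auto
  moreover have "(\<Sum>i\<in>{r<..<n}. min k c2) \<le> (\<Sum>i\<in>{r<..<n}. min k (d i))"
    using lo by (intro sum_mono) (auto simp: min_le_iff_disj)
  ultimately have *: "k * r + (n - k) * min k c2 < k * c1" using viol by (simp add: k_def)
  have "c2 \<le> k"
  proof (rule ccontr)
    assume "\<not> ?thesis"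
    then have "k * (r + (n - k)) < k * c1" using * by (simp add: distrib_left mult.commute)
    then have "r + (n - k) < c1" by (rule mult_less_cancel1[THEN iffD1, THEN conjunct2])
    then show False using \<open>c1 < n\<close> r by (simp add: k_def)
  qed
  moreover from this have **: "k * r + (n - k) * c2 < k * c1" using * by (simp add: min_absorb2)
  then have "k * r < k * c1" by linarith
  then have kc: "k \<le> c1" unfolding mult_less_cancel1 by (simp add: k_def)
  moreover have "(n - k) * c2 \<le> k * (c1 + 1 - k)"
  proof -
    have "k * c1 = k * r + k * (c1 + 1 - k)" using kc by (simp add: k_def flip: distrib_left)
    with ** show ?thesis by linarith
  qed
  ultimately show ?thesis using that by (simp add: k_def)
qed

section \<open>Relabelling of vertices and single terms of \<open>pp\<close>\<close>

lemma finite_realizations [simp]: "finite (realizations D)"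
proof -
  have "realizations D \<subseteq> Pow (nsets {..<length D} 2)" by (auto simp: realizations_def)
  then show ?thesis by (rule finite_subset) (simp add: finite_imp_finite_nsets)
qed

lemma vdegree_image_bij:
  assumes "bij q"
  shows "vdegree ((`) q ` E) (q v) = vdegree E v"
proof -
  have "{e \<in> (`) q ` E. q v \<in> e} = (`) q ` {e \<in> E. v \<in> e}"
    using assms by (auto simp: bij_def dest: injD)
  moreover have "inj_on ((`) q) {e \<in> E. v \<in> e}"
    using assms by (auto simp: bij_def inj_on_def inj_image_eq_iff)
  ultimately show ?thesis by (simp add: vdegree_def card_image)
qed

text \<open>Needed because the extremal graph comes with its vertices in a convenient order, whereas
  members of \<open>degree_interval\<close> are sorted.\<close>

lemma card_realizations_permute_list:
  assumes p: "p permutes {..<length L}"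
  shows "card (realizations (permute_list p L)) = card (realizations L)"
proof -
  \<comment> \<open>One inequality for all permutations is enough; the other is its instance for
    \<open>inv p\<close>.\<close>
  have le: "card (realizations L) \<le> card (realizations (permute_list p L))"
    if p: "p permutes {..<length L}" for p and L :: "int list"
  proof (rule card_inj_on_le)
    let ?q = "inv p"
    have q: "?q permutes {..<length L}" using p by (rule permutes_inv)
    have bij: "bij ?q" using q by (rule permutes_bij)
    then have image: "inj ((`) ?q)" by (intro injI) (simp add: bij_def inj_image_eq_iff)
    have "inj ((`) ((`) ?q))" by (intro injI) (simp add: inj_image_eq_iff[OF image])
    then show "inj_on ((`) ((`) ?q)) (realizations L)" by (rule inj_on_subset) simp
    show "(`) ((`) ?q) ` realizations L \<subseteq> realizations (permute_list p L)"
    proof safe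
      fix E assume E: "E \<in> realizations L"
      have "?q ` e \<in> nsets {..<length L} 2" if "e \<in> E" for e
      proof -
        have "e \<in> nsets {..<length L} 2" using that E by (auto simp: realizations_def)
        moreover have "card (?q ` e) = card e"
          using bij by (intro card_image) (auto simp: bij_def inj_on_def)
        ultimately show ?thesis
          using permutes_in_image[OF q] by (force simp: nsets_def)
      qed
      moreover have "int (vdegree ((`) ?q ` E) v) = permute_list p L ! v" if "v < length L" for v
      proof -
        have "vdegree ((`) ?q ` E) (?q (p v)) = vdegree E (p v)" by (rule vdegree_image_bij[OF bij])
        then show ?thesis
          using that E p permutes_in_image[OF p, of v]
          by (simp add: permute_list_nth permutes_inverses realizations_def)
      qed
      ultimately show "(`) ?q ` E \<in> realizations (permute_list p L)"
        by (auto simp: realizations_def)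
    qed
  qed simp
  have "permute_list (inv p) (permute_list p L) = L"
    using p by (simp add: permutes_inv permutes_inv_o flip: permute_list_compose)
  then show ?thesis
    using le[OF p] le[of "inv p" "permute_list p L"] permutes_inv[OF p] by simp
qed

lemma decrease_nth:
  assumes "i \<noteq> j" "v < length D"
  shows "decrease i j D ! v = D ! v - of_bool (v = i) - of_bool (v = j)"
  using assms by (auto simp: decrease_def nth_list_update)

lemma decrease_permute_list:
  assumes p: "p permutes {..<length L}" and "i \<noteq> j"
  shows "decrease i j (permute_list p L) = permute_list p (decrease (p i) (p j) L)"
proof (rule nth_equalityI)
  have len: "length (decrease x y L) = length L" for x y by (simp add: decrease_def)
  fix v assume "v < length (decrease i j (permute_list p L))"
  then have v: "v < length L" by (simp add: decrease_def)
  have inj: "p x = p y \<longleftrightarrow> x = y" for x y using permutes_inj[OF p] by (auto simp: inj_def)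
  show "decrease i j (permute_list p L) ! v = permute_list p (decrease (p i) (p j) L) ! v"
    using v assms permutes_in_image[OF p, of v] inj
    by (simp add: decrease_nth permute_list_nth len)
qed (simp add: decrease_def)

text \<open>All terms are nonnegative. The indices come unordered, since sorting a sequence may
  reverse the order of the two chosen vertices.\<close>

lemma pp_ge_term:
  assumes "i \<noteq> j" "i < length D" "j < length D"
  shows "real (card (realizations (decrease i j D))) / real (card (realizations D)) \<le> pp D"
proof -
  have *: "real (card (realizations (decrease i j D))) / real (card (realizations D)) \<le> pp D"
    if "i < j" "j < length D" for i j
  proof -
    let ?f = "\<lambda>(i, j). real (card (realizations (decrease i j D))) / real (card (realizations D))"
    have "{(i, j). i < j \<and> j < length D} \<subseteq> {..<length D} \<times> {..<length D}" by auto
    then have "finite {(i, j). i < j \<and> j < length D}" by (rule finite_subset) simp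
    then have "?f (i, j) \<le> (\<Sum>x\<in>{(i, j). i < j \<and> j < length D}. ?f x)"
      using that by (intro member_le_sum) auto
    then show ?thesis by (simp add: pp_def)
  qed
  have "decrease i j D = decrease j i D"
    using assms by (simp add: decrease_def list_update_swap)
  then show ?thesis using *[of i j] *[of j i] assms by (cases "i < j") auto
qed

section \<open>Rigidity by weights\<close>

text \<open>Every realization of the same degrees has the same total weight as \<open>E0\<close>, which is the
  largest possible, hence it agrees with \<open>E0\<close> wherever the weight of a pair does not vanish.\<close>

lemma extremal_graph_unique:
  fixes w :: "nat \<Rightarrow> int"
  assumes E0: "E0 \<subseteq> nsets {..<n} 2" and E: "E \<subseteq> nsets {..<n} 2"
    and deg: "\<And>v. v < n \<Longrightarrow> vdegree E v = vdegree E0 v"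
    and pos: "\<And>e. e \<in> nsets {..<n} 2 \<Longrightarrow> 0 < sum w e \<Longrightarrow> e \<in> E0"
    and nonneg: "\<And>e. e \<in> E0 \<Longrightarrow> 0 \<le> sum w e"
    and e: "e \<in> nsets {..<n} 2" "sum w e \<noteq> 0"
  shows "e \<in> E \<longleftrightarrow> e \<in> E0"
proof -
  let ?K = "nsets {..<n} 2"
  \<comment> \<open>Every summand \<open>?h e\<close> is nonnegative: a pair in \<open>E0\<close>
    but not in \<open>E\<close> has weight at least 0, a pair in \<open>E\<close> but not in
    \<open>E0\<close> at most 0. Equal degrees make the sum 0, so each summand vanishes.\<close>
  let ?h = "\<lambda>e. (of_bool (e \<in> E0) - of_bool (e \<in> E)) * sum w e"
  have fin: "finite ?K" by (simp add: finite_imp_finite_nsets)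
  have total: "(\<Sum>e\<in>?K. of_bool (e \<in> F) * sum w e) = (\<Sum>v<n. w v * int (vdegree F v))"
    if "F \<subseteq> ?K" for F
    unfolding sum_weighted_vdegree[OF that]
    using that fin by (intro sum.mono_neutral_cong_right) auto
  have "(\<Sum>e\<in>?K. ?h e) = 0"
    unfolding left_diff_distrib sum_subtractf total[OF E0] total[OF E] using deg by simp
  moreover have "0 \<le> ?h e" if "e \<in> ?K" for e
    using pos[OF that] nonneg[of e] by (cases "e \<in> E0"; cases "e \<in> E") force+
  ultimately have "?h e = 0" using sum_nonneg_eq_0_iff[OF fin, of ?h] e(1) by blast
  then show ?thesis using e(2) by (auto split: if_splits)
qed

text \<open>Realizations differ only on pairs of weight 0, members of \<open>H\<close> only on the
  other pairs. Hence the two choices are independent: each member of \<open>H\<close> and each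
  realization combine to a new graph, from which both can be recovered.\<close>

lemma card_realizations_decrease_ge:
  fixes w :: "nat \<Rightarrow> int"
  defines "L \<equiv> \<lambda>E n. map (\<lambda>v. int (vdegree E v)) [0..<n]"
  assumes E0: "E0 \<subseteq> nsets {..<n} 2"
    and pos: "\<And>e. e \<in> nsets {..<n} 2 \<Longrightarrow> 0 < sum w e \<Longrightarrow> e \<in> E0"
    and nonneg: "\<And>e. e \<in> E0 \<Longrightarrow> 0 \<le> sum w e"
    and ij: "i \<noteq> j"
    and H: "\<And>F. F \<in> H \<Longrightarrow> F \<subseteq> nsets {..<n} 2"
      "\<And>F e. F \<in> H \<Longrightarrow> sum w e = 0 \<Longrightarrow> e \<in> F \<longleftrightarrow> e \<in> E0"
      "\<And>F v. F \<in> H \<Longrightarrow> v < n \<Longrightarrow>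
         vdegree F v + of_bool (v = i) + of_bool (v = j) = vdegree E0 v"
  shows "card H * card (realizations (L E0 n)) \<le> card (realizations (decrease i j (L E0 n)))"
proof -
  let ?Z = "{e. sum w e \<noteq> 0}"
  let ?G = "\<lambda>(F, E). F \<inter> ?Z \<union> (E - ?Z)"
  have agree: "E \<inter> ?Z = E0 \<inter> ?Z" and EK: "E \<subseteq> nsets {..<n} 2"
    and deg: "v < n \<Longrightarrow> vdegree E v = vdegree E0 v"
    if "E \<in> realizations (L E0 n)" for E v
  proof -
    have *: "E \<subseteq> nsets {..<n} 2" "\<And>v. v < n \<Longrightarrow> vdegree E v = vdegree E0 v"
      using that by (auto simp: realizations_def L_def)
    then show "E \<subseteq> nsets {..<n} 2" "v < n \<Longrightarrow> vdegree E v = vdegree E0 v" by auto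
    show "E \<inter> ?Z = E0 \<inter> ?Z"
      using extremal_graph_unique[OF E0 * pos nonneg] * E0 by blast
  qed
  have split: "vdegree (A \<inter> ?Z \<union> (B - ?Z)) v = vdegree (A \<inter> ?Z) v + vdegree (B - ?Z) v"
    if "A \<subseteq> nsets {..<n} 2" "B \<subseteq> nsets {..<n} 2" for A B v
    using that finite_simple_graph by (intro vdegree_Un_disjoint) auto
  have split': "vdegree A v = vdegree (A \<inter> ?Z) v + vdegree (A - ?Z) v"
    if "A \<subseteq> nsets {..<n} 2" for A v
    using split[OF that that, of v] by (simp add: Int_Diff_Un)
  have FZ: "F - ?Z = E0 - ?Z" if "F \<in> H" for F using H(2)[OF that] by auto
  have "card (H \<times> realizations (L E0 n)) \<le> card (realizations (decrease i j (L E0 n)))"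
  proof (rule card_inj_on_le)
    show "inj_on ?G (H \<times> realizations (L E0 n))"
    proof (rule inj_onI, clarify)
      fix F E F' E' assume *: "F \<in> H" "E \<in> realizations (L E0 n)" "F' \<in> H"
        "E' \<in> realizations (L E0 n)" "F \<inter> ?Z \<union> (E - ?Z) = F' \<inter> ?Z \<union> (E' - ?Z)"
      then have "F \<inter> ?Z = F' \<inter> ?Z" "E - ?Z = E' - ?Z" by blast+
      then show "F = F' \<and> E = E'"
        using FZ[OF *(1)] FZ[OF *(3)] agree[OF *(2)] agree[OF *(4)] by (metis Int_Diff_Un)
    qed
    show "?G ` (H \<times> realizations (L E0 n)) \<subseteq> realizations (decrease i j (L E0 n))"
    proof clarify
      fix F E assume F: "F \<in> H" and E: "E \<in> realizations (L E0 n)"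
      let ?G = "F \<inter> ?Z \<union> (E - ?Z)"
      have "int (vdegree ?G v) = decrease i j (L E0 n) ! v" if v: "v < n" for v
      proof -
        \<comment> \<open>\<open>E\<close> has the degrees of \<open>E0\<close> in total and on
          \<open>?Z\<close>, hence also off \<open>?Z\<close>, where \<open>F\<close> coincides with
          \<open>E0\<close>.\<close>
        have "vdegree ?G v = vdegree F v"
          using split[OF H(1)[OF F] EK[OF E], of v] split'[OF H(1)[OF F], of v]
            split'[OF EK[OF E], of v] split'[OF E0, of v] FZ[OF F] agree[OF E] deg[OF E v]
          by simp
        then show ?thesis
          using H(3)[OF F v] v ij by (auto simp: decrease_nth L_def)
      qed
      moreover have "?G \<subseteq> nsets {..<n} 2" using H(1)[OF F] EK[OF E] by auto
      ultimately show "?G \<in> realizations (decrease i j (L E0 n))"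
        by (simp add: realizations_def L_def decrease_def)
    qed
  qed simp
  then show ?thesis by (simp add: card_cartesian_product)
qed

section \<open>Alternating paths in a half graph\<close>

text \<open>In a half graph with parts \<open>{..<p}\<close> and \<open>{p..<p + q}\<close>, an alternating path from \<open>2 * t\<close>
  to \<open>p\<close> visits one of the indices \<open>2 * r\<close>, \<open>2 * r + 1\<close> for each \<open>0 < r < t\<close>; the set \<open>X\<close>
  records where it takes the second one.\<close>

lemma half_graph_switches:
  assumes E0: "E0 \<subseteq> nsets {..<n} 2" and n: "p + q \<le> n" "2 * t < p" "2 * t < q"
    and half: "\<And>i j. i < p \<Longrightarrow> j < q \<Longrightarrow> {i, p + j} \<in> E0 \<longleftrightarrow> j \<le> i"
  obtains H where "card H = 2 ^ (t - 1)"
    "\<And>F. F \<in> H \<Longrightarrow> F \<subseteq> nsets {..<n} 2"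
    "\<And>F e. F \<in> H \<Longrightarrow> (\<And>i j. i < p \<Longrightarrow> j < q \<Longrightarrow> e \<noteq> {i, p + j}) \<Longrightarrow> e \<in> F \<longleftrightarrow> e \<in> E0"
    "\<And>F v. F \<in> H \<Longrightarrow> vdegree F v + of_bool (v = 2 * t) + of_bool (v = p) = vdegree E0 v"
proof -
  \<comment> \<open>At each level the path uses the rung \<open>{x X r, p + x X r}\<close>, an edge,
    and it passes between consecutive levels along the non-edge
    \<open>{x X r, p + x X (Suc r)}\<close>. It starts and ends with an edge, so exchanging its
    edges \<open>R X\<close> for its non-edges \<open>A X\<close> lowers just its two end
    vertices.\<close>
  define x where "x X r = 2 * r + of_bool (r \<in> X)" for X and r :: nat
  define R where "R X = (\<lambda>r. {x X r, p + x X r}) ` {..t}" for X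
  define A where "A X = (\<lambda>r. {x X r, p + x X (Suc r)}) ` {..<t}" for X
  define F where "F X = E0 - R X \<union> A X" for X
  have x_less: "x X r < x X r'" if "r < r'" for X r r'
    using that by (simp add: x_def)
  have x_inj: "x X r = x X r' \<longleftrightarrow> r = r'" for X r r'
    using x_less by (metis less_irrefl linorder_neqE_nat)
  have x_bound: "x X r < p" "x X r < q" if "r \<le> t" "X \<subseteq> {1..<t}" for X r
  proof -
    have "x X r \<le> 2 * t" using that by (cases "r = t") (auto simp: x_def)
    then show "x X r < p" "x X r < q" using n by auto
  qed
  \<comment> \<open>\<open>X\<close> omits 0 and \<open>t\<close>, which fixes the ends of the path
    and leaves \<open>2 ^ (t - 1)\<close> choices.\<close>
  have ends: "x X 0 = 0" "x X t = 2 * t" if "X \<subseteq> {1..<t}" for X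
    using that by (auto simp: x_def)
  have R_sub: "R X \<subseteq> E0" if "X \<subseteq> {1..<t}" for X
    using x_bound[OF _ that] half by (auto simp: R_def)
  have A_disj: "A X \<inter> E0 = {}" if "X \<subseteq> {1..<t}" for X
    using x_bound[OF _ that] half x_less[OF lessI] by (auto simp: A_def Suc_le_eq not_le[symmetric])
  have A_sub: "A X \<subseteq> nsets {..<n} 2" if "X \<subseteq> {1..<t}" for X
  proof -
    have "x X r < n" "p + x X (Suc r) < n" "x X r \<noteq> p + x X (Suc r)" if "r < t" for r
      using x_bound[of r X] x_bound[of "Suc r" X] that \<open>X \<subseteq> _\<close> n by auto
    then show ?thesis by (auto simp: A_def)
  qed
  have deg: "vdegree (F X) v + of_bool (v = 2 * t) + of_bool (v = p) = vdegree E0 v"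
    if X: "X \<subseteq> {1..<t}" for X v
  proof -
    define f where "f r = (of_bool (v = x X r) :: nat)" for r
    define g where "g r = (of_bool (v = p + x X r) :: nat)" for r
    have ne: "x X r \<noteq> p + x X r'" if "r \<le> t" for r r' using x_bound[OF that X] by auto
    have "inj_on (\<lambda>r. {x X r, p + x X r}) {..t}"
      using ne by (auto simp: inj_on_def doubleton_eq_iff x_inj)
    then have "vdegree (R X) v = (\<Sum>r\<le>t. of_bool (v \<in> {x X r, p + x X r}))"
      unfolding R_def by (intro vdegree_image) auto
    also have "\<dots> = (\<Sum>r\<le>t. f r + g r)"
      using ne n by (intro sum.cong) (auto simp: f_def g_def)
    finally have R: "vdegree (R X) v = (\<Sum>r\<le>t. f r) + (\<Sum>r\<le>t. g r)"
      by (simp add: sum.distrib)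
    have "inj_on (\<lambda>r. {x X r, p + x X (Suc r)}) {..<t}"
      using ne by (auto simp: inj_on_def doubleton_eq_iff x_inj)
    then have "vdegree (A X) v = (\<Sum>r<t. of_bool (v \<in> {x X r, p + x X (Suc r)}))"
      unfolding A_def by (intro vdegree_image) auto
    also have "\<dots> = (\<Sum>r<t. f r + g (Suc r))"
      using ne[OF less_imp_le] ne[OF less_imp_le, symmetric] n by (intro sum.cong) (auto simp: f_def g_def)
    finally have A: "vdegree (A X) v = (\<Sum>r<t. f r) + (\<Sum>r<t. g (Suc r))"
      by (simp add: sum.distrib)
    have "vdegree (F X) v + vdegree (R X) v = vdegree E0 v + vdegree (A X) v"
      unfolding F_def
      using finite_simple_graph[OF E0] finite_simple_graph[OF A_sub[OF X]] R_sub[OF X] A_disj[OF X]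
      by (rule vdegree_switch)
    moreover have "(\<Sum>r\<le>t. f r) = (\<Sum>r<t. f r) + f t"
      by (simp flip: lessThan_Suc_atMost)
    moreover have "(\<Sum>r\<le>t. g r) = g 0 + (\<Sum>r<t. g (Suc r))" by (rule sum.atMost_shift)
    ultimately show ?thesis using R A ends[OF X] by (simp add: f_def g_def)
  qed
  \<comment> \<open>The odd rung of level \<open>r\<close> is missing exactly when the path uses it,
    so \<open>F X\<close> determines \<open>X\<close>.\<close>
  have mem: "r \<in> X \<longleftrightarrow> {2 * r + 1, p + (2 * r + 1)} \<notin> F X" if X: "X \<subseteq> {1..<t}" and r: "r < t" for X r
  proof -
    have "2 * r + 1 < p" "2 * r + 1 < q" using r n by auto
    then have in_E0: "{2 * r + 1, p + (2 * r + 1)} \<in> E0" using half[of "2 * r + 1" "2 * r + 1"] by simp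
    then have "{2 * r + 1, p + (2 * r + 1)} \<notin> A X" using A_disj[OF X] by blast
    then have "{2 * r + 1, p + (2 * r + 1)} \<notin> F X \<longleftrightarrow> {2 * r + 1, p + (2 * r + 1)} \<in> R X"
      using in_E0 by (simp add: F_def)
    also have "\<dots> \<longleftrightarrow> (\<exists>r'\<le>t. 2 * r + 1 = x X r')"
    proof -
      have "{2 * r + 1, p + (2 * r + 1)} = {x X r', p + x X r'} \<longleftrightarrow> 2 * r + 1 = x X r'"
        if "r' \<le> t" for r'
        using x_bound[OF that X] \<open>2 * r + 1 < p\<close> by (auto simp: doubleton_eq_iff)
      then show ?thesis by (auto simp: R_def)
    qed
    also have "\<dots> \<longleftrightarrow> r \<in> X"
    proof
      assume "\<exists>r'\<le>t. 2 * r + 1 = x X r'"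
      then obtain r' where *: "2 * r + 1 = 2 * r' + of_bool (r' \<in> X)" by (auto simp: x_def)
      have "r' \<in> X"
      proof (rule ccontr)
        assume "r' \<notin> X"
        then have "2 * r + 1 = 2 * r'" using * by simp
        then show False by presburger
      qed
      with * show "r \<in> X" by simp
    qed (use r in \<open>auto simp: x_def intro!: exI[of _ r]\<close>)
    finally show ?thesis by blast
  qed
  have "inj_on F (Pow {1..<t})"
  proof (rule inj_onI)
    fix X Y assume XY: "X \<in> Pow {1..<t}" "Y \<in> Pow {1..<t}" "F X = F Y"
    show "X = Y"
    proof (rule set_eqI)
      fix r show "r \<in> X \<longleftrightarrow> r \<in> Y"
        using mem[of X r] mem[of Y r] XY by (cases "r < t") auto
    qed
  qed
  show ?thesis
  proof (rule that)
    show "card (F ` Pow {1..<t}) = 2 ^ (t - 1)"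
      using \<open>inj_on F (Pow {1..<t})\<close> by (simp add: card_image card_Pow)
    show "G \<subseteq> nsets {..<n} 2" if "G \<in> F ` Pow {1..<t}" for G
      using that E0 A_sub by (auto simp: F_def)
    show "e \<in> G \<longleftrightarrow> e \<in> E0"
      if "G \<in> F ` Pow {1..<t}" and ne: "\<And>i j. i < p \<Longrightarrow> j < q \<Longrightarrow> e \<noteq> {i, p + j}" for G e
    proof -
      obtain X where X: "X \<subseteq> {1..<t}" "G = F X" using \<open>G \<in> _\<close> by blast
      have ne': "e \<noteq> {x X r, p + x X r'}" if "r \<le> t" "r' \<le> t" for r r'
        using ne x_bound[OF that(1) X(1)] x_bound[OF that(2) X(1)] by blast
      have "e \<notin> R X" using ne' by (auto simp: R_def)
      moreover have "e \<notin> A X" using ne'[OF less_imp_le Suc_leI] by (auto simp: A_def)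
      ultimately show ?thesis by (simp add: X F_def)
    qed
    show "vdegree G v + of_bool (v = 2 * t) + of_bool (v = p) = vdegree E0 v"
      if "G \<in> F ` Pow {1..<t}" for G v
      using that deg by blast
  qed
qed

section \<open>The extremal graph\<close>

text \<open>Round robin: each \<open>y\<close> owns \<open>d\<close> consecutive slots, and slot
  \<open>z\<close> goes to \<open>z mod k\<close>. Since \<open>d\<close> is at most
  \<open>k\<close>, the slots of one \<open>y\<close> go to different places; since there are at
  most \<open>k * c\<close> slots, each residue occurs at most \<open>c\<close> times.\<close>

lemma balanced_incidence:
  fixes m k d c :: nat
  assumes "d \<le> k" "m * d \<le> k * c"
  obtains B where "\<And>y. y < m \<Longrightarrow> d \<le> card {x. x < k \<and> B x y}"
    "\<And>x. x < k \<Longrightarrow> card {y. y < m \<and> B x y} \<le> c"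
proof -
  define B where "B x y \<longleftrightarrow> (\<exists>z<m * d. z mod k = x \<and> z div d = y)" for x y
  have "d \<le> card {x. x < k \<and> B x y}" if y: "y < m" for y
  proof (cases "d = 0")
    case False
    then have pos: "0 < d" "0 < k" using assms by auto
    let ?I = "{y * d..<y * d + d}"
    have lt: "b - a < k" if "a \<in> ?I" "b \<in> ?I" for a b using that assms(1) by auto
    have "inj_on (\<lambda>z. z mod k) ?I"
    proof (rule linorder_inj_onI)
      fix a b assume ab: "a < b" "a \<in> ?I" "b \<in> ?I"
      show "a mod k \<noteq> b mod k"
      proof
        assume "a mod k = b mod k"
        then have "k dvd b - a" using ab by (metis mod_eq_dvd_iff_nat less_imp_le_nat)
        then show False using lt[OF ab(2,3)] ab(1) by (simp add: nat_dvd_not_less)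
      qed
    qed auto
    then have "card ((\<lambda>z. z mod k) ` ?I) = d" by (simp add: card_image)
    moreover have "(\<lambda>z. z mod k) ` ?I \<subseteq> {x. x < k \<and> B x y}"
    proof safe
      fix z assume z: "z \<in> ?I"
      have "Suc y * d \<le> m * d" using y by (intro mult_le_mono1) simp
      then have "z < m * d" using z by auto
      moreover have "z div d = y"
        using z pos by (intro div_nat_eqI) (auto simp: mult.commute)
      ultimately show "B (z mod k) y" by (auto simp: B_def)
    qed (use pos in auto)
    ultimately show ?thesis by (metis card_mono finite_Collect_conjI finite_Collect_less_nat)
  qed simp
  moreover have "card {y. y < m \<and> B x y} \<le> c" if x: "x < k" for x
  proof -
    have "{y. y < m \<and> B x y} \<subseteq> (\<lambda>l. (k * l + x) div d) ` {..<c}"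
    proof safe
      fix y assume "B x y"
      then obtain z where z: "z < m * d" "z mod k = x" "z div d = y" by (auto simp: B_def)
      have "z < c * k" using z(1) assms(2) by (simp add: mult.commute)
      then have "z div k < c" by (rule less_mult_imp_div_less)
      moreover have "y = (k * (z div k) + x) div d" using z by auto
      ultimately show "y \<in> (\<lambda>l. (k * l + x) div d) ` {..<c}" by blast
    qed
    then have "card {y. y < m \<and> B x y} \<le> card {..<c}" by (rule surj_card_le[rotated]) simp
    then show ?thesis by simp
  qed
  ultimately show ?thesis using that by blast
qed

text \<open>Vertices \<open>{..<p}\<close> and \<open>{p..<s}\<close> span a half graph between a clique and an independent
  set. The vertices \<open>{s..<s + k}\<close> are added to the clique and to the neighbourhood of every
  vertex below \<open>s\<close>; the remaining ones only have neighbours in \<open>{s..<s + k}\<close>, where the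
  weight of a pair is \<open>0\<close> and the incidences are distributed evenly.\<close>

lemma extremal_half_graph:
  assumes k: "c2 \<le> k" "k \<le> c1" "c1 < n" "(n - k) * c2 \<le> k * (c1 + 1 - k)"
    and s: "s = p + q" "0 < s"
  obtains E and w :: "nat \<Rightarrow> int" where "E \<subseteq> nsets {..<s + n} 2"
    "\<And>e. e \<in> nsets {..<s + n} 2 \<Longrightarrow> 0 < sum w e \<Longrightarrow> e \<in> E"
    "\<And>e. e \<in> E \<Longrightarrow> 0 \<le> sum w e"
    "\<And>v. v < s + n \<Longrightarrow> c2 \<le> vdegree E v \<and> vdegree E v \<le> c1 + s"
    "\<And>i j. i < p \<Longrightarrow> j < q \<Longrightarrow> {i, p + j} \<in> E \<longleftrightarrow> j \<le> i"
    "\<And>i j. i < p \<Longrightarrow> j < q \<Longrightarrow> sum w {i, p + j} \<noteq> 0"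
proof -
  obtain B where B: "\<And>y. y < n - k \<Longrightarrow> c2 \<le> card {x. x < k \<and> B x y}"
    "\<And>x. x < k \<Longrightarrow> card {y. y < n - k \<and> B x y} \<le> c1 + 1 - k"
    using balanced_incidence[OF k(1,4)] by blast
  \<comment> \<open>On the half graph, \<open>i\<close> and \<open>p + j\<close> have total weight
    2(i - j) + 1: odd, hence never 0, and positive exactly if j <= i. The value
    \<open>2 * int s + 5\<close> outweighs every vertex below \<open>s\<close>, so its sign decides
    there, and it cancels between the old clique and the old independent set.\<close>
  define w :: "nat \<Rightarrow> int" where "w v = (if v < p then 2 * int v + 1 else if v < s then - 2 * int (v - p)
    else if v < s + k then 2 * int s + 5 else - (2 * int s + 5))" for v
  define B' where "B' u v \<longleftrightarrow> (\<exists>x<k. \<exists>y<n - k. u = s + x \<and> v = s + k + y \<and> B x y)" for u v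
  define E where "E = {e \<in> nsets {..<s + n} 2. 0 < sum w e} \<union> {{u, v} |u v. B' u v}"
  have B'_range: "s \<le> u \<and> u < s + k \<and> s + k \<le> v \<and> v < s + n" if "B' u v" for u v
    using that k by (auto simp: B'_def)
  then have B'_pair: "{u, v} \<in> nsets {..<s + n} 2" "sum w {u, v} = 0" if "B' u v" for u v
  proof -
    have "s \<le> u" "u < s + k" "s + k \<le> v" "v < s + n" "u \<noteq> v" using B'_range[OF that] by auto
    then show "{u, v} \<in> nsets {..<s + n} 2" "sum w {u, v} = 0"
      using s by (auto simp: w_def)
  qed
  have E_sub: "E \<subseteq> nsets {..<s + n} 2" using B'_pair by (auto simp: E_def)
  have nonneg: "0 \<le> sum w e" if "e \<in> E" for e using that B'_pair by (auto simp: E_def)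
  have edge: "{u, v} \<in> E \<longleftrightarrow> u < s + n \<and> v < s + n \<and> u \<noteq> v \<and> 0 < w u + w v \<or> B' u v \<or> B' v u"
    for u v
    by (cases "u = v") (auto simp: E_def doubleton_eq_iff nsets_def)
  have deg: "card L \<le> vdegree E v \<and> vdegree E v \<le> card U"
    if "L \<subseteq> nbrs E v" "nbrs E v \<subseteq> U" "finite U" for v L U
    unfolding vdegree_eq_card_nbrs[OF E_sub] using that finite_nbrs[OF E_sub]
    by (simp add: card_mono)
  have "c2 \<le> vdegree E v \<and> vdegree E v \<le> c1 + s" if v: "v < s + n" for v
  proof -
    consider "v < s" | x where "x < k" "v = s + x" | y where "y < n - k" "v = s + k + y"
    proof (cases "v < s")
      case False
      then show ?thesis using that(2)[of "v - s"] that(3)[of "v - (s + k)"] v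
        by (cases "v < s + k") auto
    qed (rule that(1))
    then show ?thesis
    proof cases
      case 1
      have "{s..<s + k} \<subseteq> nbrs E v"
        using 1 k s by (auto simp: nbrs_def edge w_def)
      moreover have "nbrs E v \<subseteq> {..<s + k} - {v}"
        using 1 s B'_range by (fastforce simp: nbrs_def edge w_def split: if_splits)
      ultimately show ?thesis using deg[of "{s..<s + k}" v "{..<s + k} - {v}"] 1 k by auto
    next
      case (2 x)
      let ?Y = "(\<lambda>y. s + k + y) ` {y. y < n - k \<and> B x y}"
      have "{..<s + k} - {v} \<subseteq> nbrs E v"
        using 2 k s by (auto simp: nbrs_def edge w_def)
      moreover have "nbrs E v \<subseteq> ({..<s + k} - {v}) \<union> ?Y"
      proof
        fix u assume "u \<in> nbrs E v"
        then consider "u \<noteq> v" "0 < w u + w v" | "B' u v" | "B' v u" by (auto simp: nbrs_def edge)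
        then show "u \<in> ({..<s + k} - {v}) \<union> ?Y"
        proof cases
          case 1
          then show ?thesis using 2 s by (auto simp: w_def split: if_splits)
        qed (use 2 in \<open>auto simp: B'_def\<close>)
      qed
      ultimately have "card ({..<s + k} - {v}) \<le> vdegree E v \<and>
          vdegree E v \<le> card (({..<s + k} - {v}) \<union> ?Y)"
        by (rule deg) simp
      moreover have "card (({..<s + k} - {v}) \<union> ?Y) \<le> card ({..<s + k} - {v}) + card ?Y"
        by (rule card_Un_le)
      moreover have "card ?Y \<le> c1 + 1 - k" using B(2)[OF 2(1)] by (simp add: card_image)
      moreover have "card ({..<s + k} - {v}) = s + k - 1" using 2 by simp
      \<comment> \<open>The s + k - 1 neighbours below \<open>s + k\<close> and at most
        \<open>c1 + 1 - k\<close> others make at most \<open>c1 + s\<close>; the lower bound uses k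
        <= s + k - 1, as \<open>s\<close> is positive.\<close>
      ultimately show ?thesis using k s by linarith
    next
      case (3 y)
      let ?X = "(\<lambda>x. s + x) ` {x. x < k \<and> B x y}"
      have "?X \<subseteq> nbrs E v" using 3 by (auto simp: nbrs_def edge B'_def)
      moreover have "nbrs E v \<subseteq> {s..<s + k}"
        using 3 s B'_range by (fastforce simp: nbrs_def edge w_def split: if_splits)
      ultimately show ?thesis using deg[of ?X v "{s..<s + k}"] B(1)[OF 3(1)] k
        by (simp add: card_image)
    qed
  qed
  moreover have "{i, p + j} \<in> E \<longleftrightarrow> j \<le> i" "sum w {i, p + j} \<noteq> 0" if "i < p" "j < q" for i j
  proof -
    have w: "w i + w (p + j) = 2 * (int i - int j) + 1" using that s by (simp add: w_def)
    moreover have "\<not> B' i (p + j)" "\<not> B' (p + j) i"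
      using B'_range[of i "p + j"] B'_range[of "p + j" i] that s by auto
    ultimately show "{i, p + j} \<in> E \<longleftrightarrow> j \<le> i" using that s by (auto simp: edge)
    have "2 * (int i - int j) + 1 \<noteq> 0" by presburger
    then show "sum w {i, p + j} \<noteq> 0" using w that by simp
  qed
  moreover have "e \<in> E" if "e \<in> nsets {..<s + n} 2" "0 < sum w e" for e
    using that by (simp add: E_def)
  ultimately show ?thesis using that E_sub nonneg by blast
qed

section \<open>Growth of \<open>pp\<close> and the conclusion\<close>

lemma finite_degree_interval: "finite (degree_interval n c1 c2)"
proof -
  have "degree_interval n c1 c2 \<subseteq> {D. set D \<subseteq> {int c2..int c1} \<and> length D = n}"
    by (auto simp: degree_interval_def)
  then show ?thesis by (rule finite_subset) (simp add: finite_lists_length_eq)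
qed

text \<open>\<open>C\<close> is taken at least 1 so that \<open>ln C\<close> is nonnegative in later
  estimates.\<close>

lemma poly_le_power:
  fixes P :: "real poly"
  obtains C where "1 \<le> C" "\<And>x. 1 \<le> x \<Longrightarrow> poly P x \<le> C * x ^ degree P"
proof
  define C where "C = 1 + (\<Sum>i\<le>degree P. \<bar>coeff P i\<bar>)"
  show "1 \<le> C" by (simp add: C_def sum_nonneg)
  fix x :: real assume x: "1 \<le> x"
  have "poly P x \<le> (\<Sum>i\<le>degree P. \<bar>coeff P i\<bar> * x ^ degree P)"
    unfolding poly_altdef
    using x by (intro sum_mono mult_mono) (auto intro: power_increasing)
  also have "\<dots> \<le> C * x ^ degree P"
    using x by (simp add: C_def distrib_right flip: sum_distrib_right)
  finally show "poly P x \<le> C * x ^ degree P" .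
qed

text \<open>Assembles the construction: \<open>D'\<close> is the sorted degree sequence of the
  extremal graph, and the term of \<open>pp\<close> that is large belongs to the ends of the
  alternating paths. The degrees may reach \<open>c1 + s\<close>, hence the condition on
  \<open>c1'\<close>.\<close>

lemma nongraphic_imp_large_pp:
  assumes D: "D \<in> degree_interval n c1 c2" "\<not> graphic D" and c: "c1 < n" "c2' \<le> c2" "c1 + s \<le> c1'"
    and t: "2 * t < s div 2"
  obtains D' where "D' \<in> degree_interval (s + n) c1' c2'" "graphic D'" "2 ^ (t - 1) \<le> pp D'"
proof -
  obtain k where k: "c2 \<le> k" "k \<le> c1" "(n - k) * c2 \<le> k * (c1 + 1 - k)"
    using nongraphic_obtain_index[OF D(1) c(1) D(2)] by blast
  define p q where "p = s div 2" and "q = s - p"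
  have pq: "s = p + q" "2 * t < p" "2 * t < q" "0 < s" using t by (auto simp: p_def q_def)
  obtain E and w :: "nat \<Rightarrow> int" where E: "E \<subseteq> nsets {..<s + n} 2"
    and pos: "\<And>e. e \<in> nsets {..<s + n} 2 \<Longrightarrow> 0 < sum w e \<Longrightarrow> e \<in> E"
    and nonneg: "\<And>e. e \<in> E \<Longrightarrow> 0 \<le> sum w e"
    and deg: "\<And>v. v < s + n \<Longrightarrow> c2 \<le> vdegree E v \<and> vdegree E v \<le> c1 + s"
    and half: "\<And>i j. i < p \<Longrightarrow> j < q \<Longrightarrow> {i, p + j} \<in> E \<longleftrightarrow> j \<le> i"
    and nz: "\<And>i j. i < p \<Longrightarrow> j < q \<Longrightarrow> sum w {i, p + j} \<noteq> 0"
    using extremal_half_graph[OF k(1,2) c(1) k(3) pq(1,4)] by blast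
  have pq_le: "p + q \<le> s + n" using pq by simp
  obtain H where H: "card H = 2 ^ (t - 1)"
    "\<And>F. F \<in> H \<Longrightarrow> F \<subseteq> nsets {..<s + n} 2"
    "\<And>F e. F \<in> H \<Longrightarrow> (\<And>i j. i < p \<Longrightarrow> j < q \<Longrightarrow> e \<noteq> {i, p + j}) \<Longrightarrow> e \<in> F \<longleftrightarrow> e \<in> E"
    "\<And>F v. F \<in> H \<Longrightarrow> vdegree F v + of_bool (v = 2 * t) + of_bool (v = p) = vdegree E v"
    using half_graph_switches[OF E pq_le pq(2,3) half] by blast
  define L where "L = map (\<lambda>v. int (vdegree E v)) [0..<s + n]"
  have len: "length L = s + n" by (simp add: L_def)
  have "card H * card (realizations L) \<le> card (realizations (decrease (2 * t) p L))"
    unfolding L_def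
  proof (rule card_realizations_decrease_ge[OF E pos nonneg _ H(2)])
    \<comment> \<open>Pairs of weight 0 avoid the half graph, where alone the members of
      \<open>H\<close> differ from \<open>E\<close>.\<close>
    show "e \<in> F \<longleftrightarrow> e \<in> E" if "F \<in> H" "sum w e = 0" for F e
      using H(3)[OF that(1)] nz that(2) by metis
  qed (use pq H(4) in auto)
  then have ratio: "2 ^ (t - 1) * card (realizations L) \<le> card (realizations (decrease (2 * t) p L))"
    by (simp add: H(1))
  have "E \<in> realizations L" using E by (simp add: realizations_def L_def)
  then have card_pos: "0 < card (realizations L)" by (auto simp: card_gt_0_iff)
  define D' where "D' = rev (sort L)"
  have "mset D' = mset L" by (simp add: D'_def)
  then obtain \<pi> where \<pi>: "\<pi> permutes {..<length L}" "permute_list \<pi> L = D'"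
    by (rule mset_eq_permutation)
  have len': "length D' = s + n" by (simp add: D'_def len)
  have cardD': "card (realizations D') = card (realizations L)"
    using card_realizations_permute_list[OF \<pi>(1)] \<pi>(2) by simp
  have "graphic D'" using cardD' card_pos by (auto simp: graphic_def)
  moreover have "D' \<in> degree_interval (s + n) c1' c2'"
  proof -
    have "sorted_wrt (\<ge>) D'" by (simp add: D'_def sorted_wrt_rev)
    moreover have "set D' \<subseteq> {int c2'..int c1'}"
      using deg c by (fastforce simp: D'_def L_def)
    moreover have "sum_list D' = int (\<Sum>v<s + n. vdegree E v)"
    proof -
      have "sum_list D' = sum_list L" using \<open>mset D' = mset L\<close> by (metis sum_mset_sum_list)
      then show ?thesis by (simp add: L_def interv_sum_list_conv_sum_set_nat atLeast0LessThan)
    qed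
    ultimately show ?thesis using even_sum_vdegree[OF E] len' by (simp add: degree_interval_def del: of_nat_sum)
  qed
  moreover have "2 ^ (t - 1) \<le> pp D'"
  proof -
    \<comment> \<open>The positions to which sorting moves the path ends \<open>2 * t\<close> and
      \<open>p\<close>.\<close>
    define i j where "i = inv \<pi> (2 * t)" and "j = inv \<pi> p"
    have inv: "inv \<pi> permutes {..<length L}" using \<pi>(1) by (rule permutes_inv)
    have ij: "i \<noteq> j" "i < length D'" "j < length D'"
      using permutes_inj[OF inv] permutes_in_image[OF inv] pq len len'
      by (auto simp: i_def j_def inj_eq)
    have "decrease i j D' = permute_list \<pi> (decrease (2 * t) p L)"
      using decrease_permute_list[OF \<pi>(1) ij(1)] \<pi> by (simp add: i_def j_def permutes_inverses)
    then have "card (realizations (decrease i j D')) = card (realizations (decrease (2 * t) p L))"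
      using card_realizations_permute_list[of \<pi> "decrease (2 * t) p L"] \<pi>(1) by (simp add: decrease_def)
    then have "real (2 ^ (t - 1) * card (realizations D')) \<le> real (card (realizations (decrease i j D')))"
      using ratio cardD' by (simp only: of_nat_le_iff)
    then have "2 ^ (t - 1) \<le> real (card (realizations (decrease i j D'))) / real (card (realizations D'))"
      using card_pos cardD' by (simp add: pos_le_divide_eq)
    also have "\<dots> \<le> pp D'" by (rule pp_ge_term[OF ij])
    finally show ?thesis .
  qed
  ultimately show ?thesis using that by blast
qed

theorem theorem5p8:
  fixes n c1 c2 n' c1' c2' :: "nat \<Rightarrow> nat"
    and \<DD> \<DD>' :: "int list set"
  assumes "\<And>k. n k > c1 k" and "\<And>k. c1 k \<ge> c2 k"
    and "\<And>k. n' k > c1' k" and "\<And>k. c1' k \<ge> c2' k"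
    and "\<DD> = (\<Union>k. degree_interval (n k) (c1 k) (c2 k))"
    and "\<DD>' = (\<Union>k. degree_interval (n' k) (c1' k) (c2' k))"
    and "infinite \<DD>" and "infinite \<DD>'"
    and "\<not> almost_fully_graphic \<DD>"
    and "filterlim (\<lambda>k. (real (n' k) - real (n k)) / ln (real (n' k))) at_top sequentially"
    and "\<And>k. c2' k \<le> c2 k"
    and "\<And>k. int (c1' k) \<ge> int (c1 k) + (int (n' k) - int (n k))"
  shows "\<not> P_stable \<DD>'"
proof
  assume "P_stable \<DD>'"
  then obtain P :: "real poly"
    where P: "\<And>D. D \<in> \<DD>' \<Longrightarrow> graphic D \<Longrightarrow> pp D \<le> poly P (real (length D))"
    by (auto simp: P_stable_def)
  obtain C where C: "1 \<le> C" "\<And>x. 1 \<le> x \<Longrightarrow> poly P x \<le> C * x ^ degree P"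
    using poly_le_power[of P] by blast
  define K where "K = {k. \<exists>D \<in> degree_interval (n k) (c1 k) (c2 k). \<not> graphic D}"
  have "infinite K"
  proof
    assume "finite K"
    let ?R = "{D \<in> \<DD>. \<not> graphic D}"
    have "?R \<subseteq> (\<Union>k\<in>K. degree_interval (n k) (c1 k) (c2 k))"
      by (auto simp: K_def assms(5))
    then have "finite ?R" using \<open>finite K\<close>
      by (auto intro: finite_subset simp: finite_degree_interval)
    moreover have "fully_graphic (\<DD> - ?R)" by (auto simp: fully_graphic_def)
    ultimately show False using assms(9) by (auto simp: almost_fully_graphic_def)
  qed
  \<comment> \<open>With t - 1 >= s/4 - 3 and l = ln n', the logarithm of the polynomial bound gives
    s ln 2 <= 12 ln 2 + 4 ln C + 4 deg(P) l. As l >= ln 2, \<open>A * l\<close> dominates the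
    right-hand side, while the choice of \<open>k\<close> puts it below s ln 2.\<close>
  define A where "A = (12 * ln 2 + 4 * ln C) / ln 2 + 4 * real (degree P) + 1"
  have "\<forall>\<^sub>F k in sequentially. A / ln 2 < (real (n' k) - real (n k)) / ln (real (n' k))"
    using assms(10) by (simp add: filterlim_at_top_dense)
  then obtain k where "k \<in> K" and k: "A / ln 2 < (real (n' k) - real (n k)) / ln (real (n' k))"
    using \<open>infinite K\<close> unfolding eventually_sequentially infinite_nat_iff_unbounded_le by blast
  define s l where "s = n' k - n k" and "l = ln (real (n' k))"
  have A: "12 \<le> A" using C(1) by (simp add: A_def add_divide_distrib)
  then have quot: "0 < (real (n' k) - real (n k)) / l"
    using k by (simp add: l_def) (smt (verit) divide_pos_pos ln_gt_zero)
  \<comment> \<open>For \<open>n' k = 1\<close> the quotient would be 0, the default value of a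
    division by ln 1 = 0. Its positivity also gives \<open>n k < n' k\<close> below, so the
    truncated subtraction in \<open>s\<close> is exact.\<close>
  then have "n' k \<noteq> 1" by (auto simp: l_def)
  then have n'2: "2 \<le> n' k" using assms(3)[of k] by simp
  then have l: "ln 2 \<le> l" "0 < l" by (auto simp: l_def)
  then have "n k < n' k" using quot by (simp add: zero_less_divide_iff)
  then have s: "n' k = s + n k" by (simp add: s_def)
  have "A / ln 2 < real s / l" using k by (simp add: s l_def)
  then have large: "A * l < real s * ln 2" using l by (simp add: field_simps)
  have "A * ln 2 \<le> A * l" using l A by simp
  with large have "A < real s" by (smt (verit) ln_gt_zero mult_less_cancel_right)
  then have s12: "12 < s" using A by linarith
  \<comment> \<open>Subtracting 1 makes \<open>2 * t < s div 2\<close> strict. Rounding and the two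
    units subtracted in \<open>t - 1\<close> cost less than 3.\<close>
  define t where "t = s div 4 - 1"
  have t: "2 * t < s div 2" "real s / 4 - 3 \<le> real (t - 1)"
    using s12 by (auto simp: t_def)
  obtain D where D: "D \<in> degree_interval (n k) (c1 k) (c2 k)" "\<not> graphic D"
    using \<open>k \<in> K\<close> by (auto simp: K_def)
  have "c1 k + s \<le> c1' k" using assms(12)[of k] s by simp
  then obtain D' where D': "D' \<in> degree_interval (s + n k) (c1' k) (c2' k)" "graphic D'"
    and pp: "2 ^ (t - 1) \<le> pp D'"
    using nongraphic_imp_large_pp[OF D assms(1,11) _ t(1)] by metis
  have "D' \<in> \<DD>'" using D'(1) by (auto simp: assms(6) s[symmetric])
  then have "2 ^ (t - 1) \<le> poly P (real (length D'))" using P D'(2) pp by force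
  also have "\<dots> \<le> C * real (n' k) ^ degree P"
    using D'(1) C(2)[of "real (n' k)"] n'2 by (simp add: degree_interval_def s)
  finally have "ln (2 ^ (t - 1)) \<le> ln (C * real (n' k) ^ degree P)"
    using C(1) n'2 by (subst ln_le_cancel_iff) auto
  then have "real (t - 1) * ln 2 \<le> ln C + real (degree P) * l"
    using C(1) n'2 by (simp add: ln_mult ln_realpow l_def)
  moreover have "(real s / 4 - 3) * ln 2 \<le> real (t - 1) * ln 2"
    using t(2) by (intro mult_right_mono) auto
  ultimately have "real s * ln 2 \<le> 12 * ln 2 + 4 * ln C + 4 * real (degree P) * l"
    by (simp add: algebra_simps)
  also have "\<dots> \<le> A * l"
  proof -
    have "(12 * ln 2 + 4 * ln C) * 1 \<le> (12 * ln 2 + 4 * ln C) * (l / ln 2)"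
      using l C(1) by (intro mult_left_mono) auto
    then show ?thesis using l by (simp add: A_def distrib_right)
  qed
  finally show False using large by simp
qed

end
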